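(* Let $n>0$. Define inductively $\mathcal{F}_0(\mathbb{N}^n):=\mathbb{N}^n$ (with the product ordering) and $\mathcal{F}_{k+1}(\mathbb{N}^n):=\mathcal{F}\bigl(\mathcal{F}_k(\mathbb{N}^n)\bigr)$ for all $k\in\mathbb{N}$. Then each of the sets $\mathcal{F}_1(\mathbb{N}^n),\mathcal{F}_2(\mathbb{N}^n),\dots$, ordered by reverse inclusion, is Noetherian.
   Context: $\mathbb{N}=\{0,1,2,\dots\}$. For an ordered (i.e. partially ordered) set $(S,\leq)$, a final segment of $S$ is a subset $F\subseteq S$ such that $x\in F$, $x\leq y$ imply $y\in F$. $\mathcal{F}(S)$ denotes the set of all final segments of $S$, ordered by reverse inclusion ($F\leq G$ iff $F\supseteq G$). An ordered set is Noetherian if it is well-founded (there is no infinite strictly decreasing sequence) and every antichain (set of pairwise incomparable elements) is finite. *)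

theory Defs
  imports "HOL-Analysis.Finite_Cartesian_Product" "HOL-Library.Countable_Set_Type"
begin

definition final_segments :: "'a::order set \<Rightarrow> 'a set set" where
  "final_segments S = {F. F \<subseteq> S \<and> (\<forall>x\<in>F. \<forall>y\<in>S. x \<le> y \<longrightarrow> y \<in> F)}"

definition antichain :: "'a::order set \<Rightarrow> bool" where
  "antichain A \<longleftrightarrow> (\<forall>x\<in>A. \<forall>y\<in>A. x \<noteq> y \<longrightarrow> \<not> x \<le> y \<and> \<not> y \<le> x)"

definition Noetherian :: "'a::order set \<Rightarrow> bool" where
  "Noetherian S \<longleftrightarrow>
     (\<nexists>f :: nat \<Rightarrow> 'a. (\<forall>i. f i \<in> S) \<and> (\<forall>i. f (Suc i) < f i)) \<and>
     (\<forall>A\<subseteq>S. antichain A \<longrightarrow> finite A)"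

text \<open>
  The k-th iterate is a set of sets of sets \<dots> (k levels) over the base order, so the iterates for
  varying k do not naturally live in one HOL type. The type below collects all levels: it is
  generated by points of the base order and by countable sets of objects already constructed.
  A BNF datatype only admits recursion through sets of bounded size, hence the restriction to
  countable sets. Since it could discard final segments, \<open>all_segments_present k\<close> below states that
  nothing is lost in passing from level k to level k + 1; if it holds at all levels, then each level
  is (up to the constructor \<open>Seg\<close>) the set of all final segments of the previous one.
\<close>

datatype 'a hseg = Pt 'a | Seg "'a hseg cset"

text \<open>
  Points are compared in the base order, segments by reverse inclusion. Points and segments never
  occur at the same level; they are declared incomparable.
\<close>

fun le_hseg :: "'a::order hseg \<Rightarrow> 'a hseg \<Rightarrow> bool" where
  "le_hseg (Pt x) (Pt y) \<longleftrightarrow> x \<le> y"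
| "le_hseg (Seg F) (Seg G) \<longleftrightarrow> rcset G \<subseteq> rcset F"
| "le_hseg _ _ \<longleftrightarrow> False"

instantiation hseg :: (order) order
begin

definition less_eq_hseg :: "'a hseg \<Rightarrow> 'a hseg \<Rightarrow> bool" where
  "x \<le> y \<longleftrightarrow> le_hseg x y"

definition less_hseg :: "'a hseg \<Rightarrow> 'a hseg \<Rightarrow> bool" where
  "(x :: 'a hseg) < y \<longleftrightarrow> x \<le> y \<and> \<not> y \<le> x"

instance
proof
  fix x y z :: "'a hseg"
  show "x < y \<longleftrightarrow> x \<le> y \<and> \<not> y \<le> x"
    by (rule less_hseg_def)
  show "x \<le> x"
    by (cases x) (auto simp: less_eq_hseg_def)
  show "x \<le> y \<Longrightarrow> y \<le> z \<Longrightarrow> x \<le> z"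
    by (cases x; cases y; cases z) (auto simp: less_eq_hseg_def)
  show "x \<le> y \<Longrightarrow> y \<le> x \<Longrightarrow> x = y"
    by (cases x; cases y) (auto simp: less_eq_hseg_def rcset_inject[symmetric])
qed

end

lemma Pt_le_Pt [simp]: "Pt x \<le> Pt y \<longleftrightarrow> x \<le> y"
  and Seg_le_Seg [simp]: "Seg F \<le> Seg G \<longleftrightarrow> rcset G \<subseteq> rcset F"
  by (simp_all add: less_eq_hseg_def)

primrec iter_segments :: "nat \<Rightarrow> 'a::order hseg set" where
  "iter_segments 0 = range Pt"
| "iter_segments (Suc k) = {Seg F |F. rcset F \<in> final_segments (iter_segments k)}"

text \<open>
  The right-hand side is the unrestricted set of all final segments, so the equation says that
  level k + 1 is not truncated.
\<close>

definition all_segments_present :: "'a::order itself \<Rightarrow> nat \<Rightarrow> bool" where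
  "all_segments_present _ k \<longleftrightarrow>
     {rcset F |F. Seg F \<in> (iter_segments (Suc k) :: 'a hseg set)} =
       final_segments (iter_segments k)"

lemma all_segments_present_if_countable:
  assumes "countable (iter_segments k :: 'a::order hseg set)"
  shows "all_segments_present TYPE('a) k"
proof -
  have "\<exists>F. G = rcset F" if "G \<in> final_segments (iter_segments k :: 'a hseg set)" for G
  proof -
    have "countable G"
      using that assms countable_subset by (auto simp: final_segments_def)
    then have "rcset (acset G) = G"
      by (simp add: acset_inverse)
    then show ?thesis by metis
  qed
  then show ?thesis
    unfolding all_segments_present_def by auto
qed

end

theory Submission
  imports Defs "HOL-Library.Ramsey"
begin

text \<open>
  Being well-quasi-ordered does not in general pass from \<open>S\<close> to its final segments, so a stronger
  property has to be carried along the iteration. For finitely many iterations the following weak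
  form of Nash-Williams' better-quasi-orders suffices. Colour the \<open>m\<close>-element sets of natural
  numbers with elements of \<open>S\<close>. From an \<open>(m + 1)\<close>-set \<open>X\<close> one obtains two \<open>m\<close>-sets:
  \<open>X - {Max X}\<close> and its shift \<open>X - {Min X}\<close>. The colouring is bad if the colour of the former is
  never below the colour of the latter, and \<open>array_wqo m S\<close> says that there is no bad colouring. For
  \<open>m = 1\<close> the colourings are the sequences in \<open>S\<close>, so \<open>array_wqo 1\<close> is the usual property that
  \<open>f i \<le> f j\<close> for some \<open>i < j\<close>, which implies that \<open>S\<close> is Noetherian
  (\<open>Noetherian_if_array_wqo\<close>).

  A bad colouring of \<open>m\<close>-sets by final segments of \<open>S\<close> yields a bad colouring of
  \<open>(m + 1)\<close>-sets by elements of \<open>S\<close>: choose witnesses for the failing inclusions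
  (\<open>array_wqo_segments\<close>). Hence it is enough that the vectors of natural numbers admit no bad
  colouring for any \<open>m\<close>. This follows from Ramsey's theorem, which makes one coordinate descend
  forever (\<open>array_wqo_nat_vec\<close>).

  Finally, no final segment is lost at any level: a final segment of a Noetherian set is generated by
  its finitely many minimal elements, so a countable Noetherian set has only countably many final
  segments (\<open>countable_final_segments\<close>), and all levels are countable by induction.
\<close>

section \<open>Orders without bad colourings of finite sets\<close>

definition array_wqo :: "nat \<Rightarrow> 'a::order set \<Rightarrow> bool" where
  "array_wqo m S \<longleftrightarrow>
     (\<forall>f :: nat set \<Rightarrow> 'a. (\<forall>X. finite X \<and> card X = m \<longrightarrow> f X \<in> S) \<longrightarrow>
       (\<exists>X. finite X \<and> card X = Suc m \<and> f (X - {Max X}) \<le> f (X - {Min X})))"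

lemma array_wqoE:
  fixes f :: "nat set \<Rightarrow> 'a::order"
  assumes "array_wqo m S" and "\<And>X. finite X \<Longrightarrow> card X = m \<Longrightarrow> f X \<in> S"
  obtains X where "finite X" "card X = Suc m" "f (X - {Max X}) \<le> f (X - {Min X})"
proof -
  from assms(1) have "(\<forall>X. finite X \<and> card X = m \<longrightarrow> f X \<in> S) \<longrightarrow>
      (\<exists>X. finite X \<and> card X = Suc m \<and> f (X - {Max X}) \<le> f (X - {Min X}))"
    unfolding array_wqo_def by (rule spec)
  with assms(2) that show thesis by blast
qed

text \<open>
  A sequence is a colouring of the singletons, read off at their minimum; a two-element set and its
  two trimmed versions are then just a pair of indices.
\<close>

lemma array_wqo_1E:
  fixes f :: "nat \<Rightarrow> 'a::order"
  assumes "array_wqo 1 S" and "\<And>i. f i \<in> S"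
  obtains i j where "i < j" "f i \<le> f j"
proof -
  obtain X :: "nat set" where X: "finite X" "card X = Suc 1"
    and le: "f (Min (X - {Max X})) \<le> f (Min (X - {Min X}))"
    by (rule array_wqoE[OF assms(1), of "\<lambda>X. f (Min X)"]) (use assms(2) in simp_all)
  from X(2) have "card X = 2"
    by simp
  then obtain a b where ab: "X = {a, b}" "a \<noteq> b"
    unfolding card_2_iff by blast
  then have "X = {min a b, max a b}" "min a b < max a b"
    by (auto simp: min_def max_def)
  then obtain i j where "X = {i, j}" "i < j"
    by (rule that)
  then have "X - {Max X} = {i}" "X - {Min X} = {j}"
    by auto
  with le \<open>i < j\<close> that show thesis
    by simp
qed

lemma Noetherian_if_array_wqo:
  fixes S :: "'a::order set"
  assumes "array_wqo 1 S"
  shows "Noetherian S"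
  unfolding Noetherian_def
proof (intro conjI allI impI notI)
  assume "\<exists>f :: nat \<Rightarrow> 'a. (\<forall>i. f i \<in> S) \<and> (\<forall>i. f (Suc i) < f i)"
  then obtain f :: "nat \<Rightarrow> 'a" where f: "\<And>i. f i \<in> S" "\<And>i. f (Suc i) < f i"
    by blast
  obtain i j where "i < j" "f i \<le> f j"
    by (rule array_wqo_1E[OF assms f(1)])
  moreover have "f j < f i"
    using \<open>i < j\<close> by (induction rule: less_Suc_induct) (auto intro: f(2) less_trans)
  ultimately show False by simp
next
  fix A assume A: "A \<subseteq> S" "antichain A"
  show "finite A"
  proof (rule ccontr)
    assume "infinite A"
    then obtain f :: "nat \<Rightarrow> 'a" where f: "inj f" "range f \<subseteq> A"
      using infinite_countable_subset[of A] by auto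
    then have f_in: "f i \<in> A" for i
      by auto
    then have "f i \<in> S" for i
      using A(1) by auto
    then obtain i j where "i < j" "f i \<le> f j"
      using array_wqo_1E[OF assms] by metis
    moreover have "f i \<noteq> f j"
      using injD[OF f(1)] \<open>i < j\<close> by auto
    ultimately show False
      using A(2) f_in[of i] f_in[of j] by (simp add: antichain_def)
  qed
qed

lemma card_remove_Max_Min:
  fixes X :: "nat set"
  assumes "finite X" and "card X = Suc m"
  shows "card (X - {Max X}) = m" and "card (X - {Min X}) = m"
proof -
  have "X \<noteq> {}"
    using assms(2) by auto
  then show "card (X - {Max X}) = m" "card (X - {Min X}) = m"
    using assms by simp_all
qed

text \<open>
  The two sets \<open>X - {Max X}\<close> and \<open>X - {Min X}\<close> overlap in \<open>X\<close> without its two ends, and this overlap arises as the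
  shift of the former as well as by trimming the latter from above. That is how witnesses chosen for
  the two sets become comparable in the next section. With at least two elements the ends differ, so
  that deleting one of them leaves the other one in place.
\<close>

lemma remove_Max_Min_commute:
  fixes X :: "nat set"
  assumes "finite X" and "card X = Suc (Suc m)"
  shows "X - {Max X} - {Min (X - {Max X})} = X - {Min X} - {Max (X - {Min X})}"
proof -
  have ne: "X \<noteq> {}" "X - {Max X} \<noteq> {}" "X - {Min X} \<noteq> {}"
    using assms card_remove_Max_Min[OF assms] by (metis card.empty nat.distinct(1))+
  then have "Min (X - {Max X}) \<in> X - {Max X}" "Max (X - {Min X}) \<in> X - {Min X}"
    using assms(1) by (intro Min_in Max_in; simp)+
  have "Min X \<noteq> Max X"
  proof
    assume eq: "Min X = Max X"
    have "x = Max X" if "x \<in> X" for x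
      using Min_le[OF assms(1) that] Max_ge[OF assms(1) that] eq by simp
    then show False
      using ne(2) by blast
  qed
  then have "Min (X - {Max X}) = Min X"  "Max (X - {Min X}) = Max X"
    using assms(1) ne(1) by (intro Min_eqI Max_eqI; simp)+
  then show ?thesis
    by auto
qed

section \<open>Passing to final segments\<close>

text \<open>
  Let \<open>f\<close> be a bad colouring of \<open>m\<close>-sets by final segments. For an \<open>(m + 1)\<close>-set \<open>X\<close>
  badness means that \<open>f (X - {Min X})\<close> is not contained in \<open>f (X - {Max X})\<close>; let \<open>g X\<close> be a
  witness. If \<open>g\<close> were good at an \<open>(m + 2)\<close>-set \<open>X\<close> with middle part \<open>M\<close>, then
  \<open>g (X - {Max X})\<close>, which lies in the segment \<open>f M\<close>, would be below \<open>g (X - {Min X})\<close>, which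
  lies outside \<open>f M\<close>; but segments are closed upwards.
\<close>

lemma array_wqo_segments:
  fixes S :: "'a::order hseg set"
  assumes "array_wqo (Suc m) S"
  shows "array_wqo m {Seg F |F. rcset F \<in> final_segments S}"
  unfolding array_wqo_def
proof (intro allI impI, rule ccontr)
  fix f :: "nat set \<Rightarrow> 'a hseg"
  assume f: "\<forall>X. finite X \<and> card X = m \<longrightarrow> f X \<in> {Seg F |F. rcset F \<in> final_segments S}"
    and bad: "\<nexists>X. finite X \<and> card X = Suc m \<and> f (X - {Max X}) \<le> f (X - {Min X})"
  have "\<exists>F. f X = Seg F \<and> rcset F \<in> final_segments S" if "finite X" "card X = m" for X
    using f[rule_format, of X] that by simp
  then obtain s where f_eq: "f X = Seg (s X)" and s: "rcset (s X) \<in> final_segments S"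
    if "finite X" "card X = m" for X
    by metis
  have "\<exists>y. y \<in> rcset (s (X - {Min X})) \<and> y \<notin> rcset (s (X - {Max X}))"
    if X: "finite X" "card X = Suc m" for X
  proof -
    have "\<not> f (X - {Max X}) \<le> f (X - {Min X})"
      using bad X by blast
    then show ?thesis
      using f_eq[of "X - {Max X}"] f_eq[of "X - {Min X}"] X card_remove_Max_Min[OF X] by auto
  qed
  then obtain g where g: "g X \<in> rcset (s (X - {Min X}))" "g X \<notin> rcset (s (X - {Max X}))"
    if "finite X" "card X = Suc m" for X
    by metis
  have g_in: "g X \<in> S" if X: "finite X" "card X = Suc m" for X
    using g(1)[OF X] s[of "X - {Min X}"] X card_remove_Max_Min[OF X] by (auto simp: final_segments_def)
  obtain X where X: "finite X" "card X = Suc (Suc m)"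
    and le: "g (X - {Max X}) \<le> g (X - {Min X})"
    by (rule array_wqoE[OF assms g_in])
  define M where "M = X - {Max X} - {Min (X - {Max X})}"
  have M: "M = X - {Min X} - {Max (X - {Min X})}"
    unfolding M_def by (rule remove_Max_Min_commute[OF X])
  have "finite M" "card M = m"
    using card_remove_Max_Min[of "X - {Max X}" m] card_remove_Max_Min[OF X] X(1) by (simp_all add: M_def)
  then have "rcset (s M) \<in> final_segments S"
    by (rule s)
  moreover have "g (X - {Max X}) \<in> rcset (s M)"
    unfolding M_def by (rule g) (use X(1) card_remove_Max_Min[OF X] in simp_all)
  moreover have "g (X - {Min X}) \<notin> rcset (s M)"
    unfolding M by (rule g) (use X(1) card_remove_Max_Min[OF X] in simp_all)
  moreover have "g (X - {Min X}) \<in> S"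
    by (rule g_in) (use X(1) card_remove_Max_Min[OF X] in simp_all)
  ultimately show False
    using le by (simp add: final_segments_def)
qed

section \<open>Vectors of natural numbers\<close>

lemma remove_Max_Min_block:
  fixes e :: "nat \<Rightarrow> nat"
  assumes "strict_mono e"
  shows "card (e ` {i..i + m}) = Suc m"
    and "e ` {i..i + m} - {Max (e ` {i..i + m})} = e ` {i..<i + m}"
    and "e ` {i..i + m} - {Min (e ` {i..i + m})} = e ` {Suc i..<Suc i + m}"
proof -
  have inj: "inj e"
    using assms by (rule strict_mono_imp_inj_on)
  then show "card (e ` {i..i + m}) = Suc m"
    by (simp add: card_image inj_on_subset)
  have "Max (e ` {i..i + m}) = e (i + m)" "Min (e ` {i..i + m}) = e i"
    using assms by (auto intro!: Min_eqI Max_eqI simp: strict_mono_less_eq)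
  moreover have "{i..i + m} - {i + m} = {i..<i + m}" "{i..i + m} - {i} = {Suc i..<Suc i + m}"
    by auto
  ultimately show "e ` {i..i + m} - {Max (e ` {i..i + m})} = e ` {i..<i + m}"
    and "e ` {i..i + m} - {Min (e ` {i..i + m})} = e ` {Suc i..<Suc i + m}"
    using image_set_diff[OF inj, of "{i..i + m}" "{i + m}"]
      image_set_diff[OF inj, of "{i..i + m}" "{i}"] by simp_all
qed

text \<open>
  Vectors fail to be comparable at some coordinate, and there are only finitely many coordinates, so
  Ramsey's theorem finds an infinite set \<open>e 0 < e 1 < \<dots>\<close> on all of whose \<open>(m + 1)\<close>-subsets the
  same coordinate decreases. Along the blocks \<open>e i, \<dots>, e (i + m - 1)\<close>, each of which is the shift
  of its predecessor, this coordinate decreases forever.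
\<close>

lemma array_wqo_nat_vec: "array_wqo m (range Pt :: (nat ^ 'n) hseg set)"
  unfolding array_wqo_def
proof (intro allI impI, rule ccontr)
  fix f :: "nat set \<Rightarrow> (nat ^ 'n) hseg"
  assume f: "\<forall>X. finite X \<and> card X = m \<longrightarrow> f X \<in> range Pt"
    and bad: "\<nexists>X. finite X \<and> card X = Suc m \<and> f (X - {Max X}) \<le> f (X - {Min X})"
  have "\<exists>x. f X = Pt x" if "finite X" "card X = m" for X
    using f[rule_format, of X] that by auto
  then obtain v where v: "f X = Pt (v X)" if "finite X" "card X = m" for X
    by metis
  have "\<exists>i. v (X - {Min X}) $ i < v (X - {Max X}) $ i" if X: "finite X" "card X = Suc m" for X
  proof -
    have "\<not> f (X - {Max X}) \<le> f (X - {Min X})"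
      using bad X by blast
    then show ?thesis
      using v[of "X - {Max X}"] v[of "X - {Min X}"] X card_remove_Max_Min[OF X]
      by (simp add: less_eq_vec_def not_le)
  qed
  then obtain c where c: "v (X - {Min X}) $ c X < v (X - {Max X}) $ c X"
    if "finite X" "card X = Suc m" for X
    by metis
  \<comment> \<open>Ramsey's theorem is stated for colours that are natural numbers; \<open>h\<close> numbers the coordinates.\<close>
  obtain h :: "'n \<Rightarrow> nat" where h: "bij_betw h UNIV {0..<CARD('n)}"
    using ex_bij_betw_finite_nat[of "UNIV :: 'n set"] by auto
  have "h (c X) < CARD('n)" for X
    using bij_betwE[OF h] by auto
  then obtain Y t where Y: "infinite (Y :: nat set)"
    and t: "\<forall>X. X \<subseteq> Y \<and> finite X \<and> card X = Suc m \<longrightarrow> h (c X) = t"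
    using Ramsey[of "UNIV :: nat set" "Suc m" "\<lambda>X. h (c X)" "CARD('n)"] by auto
  define e where "e = enumerate Y"
  have e: "strict_mono e" "\<And>i. e i \<in> Y"
    using Y by (auto simp: e_def strict_mono_enumerate enumerate_in_set)
  define k where "k = inv h t"
  have k: "c (e ` {i..i + m}) = k" for i
  proof -
    have "h (c (e ` {i..i + m})) = t"
      by (rule t[rule_format]) (use e remove_Max_Min_block(1)[OF e(1)] in auto)
    then show ?thesis
      using bij_betw_imp_inj_on[OF h] unfolding k_def by (metis inv_f_f)
  qed
  define d where "d i = v (e ` {i..<i + m}) $ k" for i
  have "d (Suc i) < d i" for i
    using c[of "e ` {i..i + m}"] unfolding d_def k remove_Max_Min_block[OF e(1)] by simp
  then have "\<exists>d. \<forall>i. (d (Suc i), d i) \<in> {(x, y :: nat). x < y}"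
    by auto
  then show False
    using wf unfolding wf_iff_no_infinite_down_chain by blast
qed

section \<open>Final segments of a countable Noetherian set\<close>

text \<open>
  A final segment \<open>F\<close> of a Noetherian set is the upward closure of the set of its minimal
  elements, which is an antichain and hence finite. So there are no more final segments than finite
  subsets.
\<close>

lemma countable_final_segments:
  fixes S :: "'a::order set"
  assumes "countable S" and N: "Noetherian S"
  shows "countable (final_segments S)"
proof -
  have fin_antichain: "finite A" if "A \<subseteq> S" "antichain A" for A
    using N that by (simp add: Noetherian_def)
  have wf: "wf {(x, y). x \<in> S \<and> y \<in> S \<and> x < y}"
    using N unfolding wf_iff_no_infinite_down_chain Noetherian_def by auto
  define gen where "gen B = {y \<in> S. \<exists>b\<in>B. b \<le> y}" for B
  have "final_segments S \<subseteq> gen ` {B. finite B \<and> B \<subseteq> S}"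
  proof
    fix F assume F: "F \<in> final_segments S"
    then have sub: "F \<subseteq> S"
      by (simp add: final_segments_def)
    define B where "B = {b \<in> F. \<forall>y\<in>F. \<not> y < b}"
    have "B \<subseteq> S"
      using sub by (auto simp: B_def)
    moreover have "antichain B"
      by (auto simp: antichain_def B_def order.order_iff_strict)
    ultimately have B: "B \<in> {B. finite B \<and> B \<subseteq> S}"
      using fin_antichain by blast
    have "\<exists>b\<in>B. b \<le> x" if "x \<in> F" for x
      using that
    proof (induction x rule: wf_induct_rule[OF wf])
      case (1 x)
      show ?case
      proof (cases "x \<in> B")
        case False
        then obtain y where y: "y \<in> F" "y < x"
          using 1(2) by (auto simp: B_def)
        then obtain b where "b \<in> B" "b \<le> y"
          using 1 sub by blast
        then show ?thesis
          using y(2) by (meson less_imp_le order_trans)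
      qed blast
    qed
    then have "F = gen B"
      using F by (auto simp: gen_def final_segments_def B_def)
    then show "F \<in> gen ` {B. finite B \<and> B \<subseteq> S}"
      using B by (rule image_eqI)
  qed
  moreover have "countable (gen ` {B. finite B \<and> B \<subseteq> S})"
    using countable_Collect_finite_subset[OF assms(1)] by (rule countable_image)
  ultimately show ?thesis
    by (rule countable_subset)
qed

section \<open>The iterates\<close>

text \<open>
  The induction needs all \<open>m\<close> at once: \<open>m\<close>-sets at one level are reduced to \<open>(m + 1)\<close>-sets at the
  level below.
\<close>

lemma array_wqo_iter_segments: "array_wqo m (iter_segments k :: (nat ^ 'n) hseg set)"
  by (induction k arbitrary: m) (simp_all add: array_wqo_nat_vec array_wqo_segments)

lemma Noetherian_iter_segments: "Noetherian (iter_segments k :: (nat ^ 'n) hseg set)"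
  by (intro Noetherian_if_array_wqo array_wqo_iter_segments)

lemma countable_iter_segments: "countable (iter_segments k :: (nat ^ 'n) hseg set)"
proof (induction k)
  case (Suc k)
  let ?segs = "final_segments (iter_segments k :: (nat ^ 'n) hseg set)"
  have "iter_segments (Suc k) \<subseteq> (\<lambda>F. Seg (acset F)) ` ?segs"
  proof
    fix x :: "(nat ^ 'n) hseg" assume "x \<in> iter_segments (Suc k)"
    then obtain F where F: "x = Seg F" "rcset F \<in> ?segs"
      by auto
    from F(1) have "x = Seg (acset (rcset F))"
      by (simp add: rcset_inverse)
    then show "x \<in> (\<lambda>F. Seg (acset F)) ` ?segs"
      using F(2) by (rule image_eqI)
  qed
  moreover have "countable ((\<lambda>F. Seg (acset F)) ` ?segs)"
    by (intro countable_image countable_final_segments Suc.IH Noetherian_iter_segments)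
  ultimately show ?case
    by (rule countable_subset)
qed simp

theorem theorem5p9:
  shows "(\<forall>k. all_segments_present TYPE(nat ^ 'n) k) \<and>
         (\<forall>k\<ge>1. Noetherian (iter_segments k :: (nat ^ 'n) hseg set))"
  using all_segments_present_if_countable countable_iter_segments Noetherian_iter_segments
  by blast
end
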